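(* Let $\epsilon>0$. Then there is a constant $T=T(\epsilon)$ such that for every positive integer $t$ and every real number $f$ with $T<f\leq\log t$, there is a graph $G$ satisfying $e(G)/|G|\geq(2\alpha-\epsilon)t\sqrt{f}$ which does not contain $K_{\lfloor ft/\log t\rfloor,\,t}$ as a minor. In particular, $c(K_{\lfloor ft/\log t\rfloor,\,t})\geq(2\alpha-\epsilon)t\sqrt{f}$.
   Context: Graphs are finite and simple; $|G|$ and $e(G)$ denote the numbers of vertices and edges; $\log$ is the natural logarithm. $K_{s,t}$ is the complete bipartite graph with classes of sizes $s$ and $t$. A graph $H$ is a minor of $G$ if there are disjoint non-empty sets $(V_h)_{h\in V(H)}$ of vertices of $G$, each inducing a connected subgraph, such that for every edge $hh'$ of $H$ there is an edge of $G$ between $V_h$ and $V_{h'}$. Define $c(H)=\inf\{c: \text{every graph } G \text{ with } e(G)/|G|\geq c \text{ contains } H \text{ as a minor}\}$. The constant $\alpha=\max_{0<p<1}\frac{p}{2\sqrt{\log(1/(1-p))}}=0.319\ldots$. *)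

theory Defs
  imports
    "HOL-Analysis.Analysis"
    "HOL-Real_Asymp.Real_Asymp"
    "Graph_Theory.Graph_Theory"
begin

text \<open>
  Finite simple graphs are the \<^locale>\<open>pair_graph\<close>s of the library: finite, loopless digraphs with
  a symmetric arc relation. Every undirected edge is therefore represented by two arcs, so \<open>e(G)\<close>
  is not \<^term>\<open>card (parcs G)\<close>; the edges are recovered as unordered pairs.
\<close>

definition edges :: "'a pair_pre_digraph \<Rightarrow> 'a set set" where
  "edges G = (\<lambda>(u, v). {u, v}) ` parcs G"

definition edge_density :: "'a pair_pre_digraph \<Rightarrow> real" where
  "edge_density G = real (card (edges G)) / real (card (pverts G))"

definition is_minor :: "'h pair_pre_digraph \<Rightarrow> 'a pair_pre_digraph \<Rightarrow> bool" where
  "is_minor H G \<longleftrightarrow> (\<exists>V :: 'h \<Rightarrow> 'a set.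
     (\<forall>h \<in> pverts H. V h \<subseteq> pverts G \<and> V h \<noteq> {}
        \<and> Digraph_Component.connected (with_proj G \<restriction> V h)) \<and>
     disjoint_family_on V (pverts H) \<and>
     (\<forall>(h, h') \<in> parcs H. \<exists>u \<in> V h. \<exists>v \<in> V h'. (u, v) \<in> parcs G))"

definition complete_bipartite :: "nat \<Rightarrow> nat \<Rightarrow> (nat + nat) pair_pre_digraph" where
  "complete_bipartite s t =
     (let A = Inl ` {..<s}; B = Inr ` {..<t}
      in \<lparr> pverts = A \<union> B, parcs = A \<times> B \<union> B \<times> A \<rparr>)"

lemma complete_bipartite_is_K: "complete_bipartite_digraph s t (with_proj (complete_bipartite s t))"
  unfolding complete_bipartite_digraph_pair_def
proof (intro conjI exI)
  show "card (Inl ` {..<s} :: (nat + nat) set) = s" "card (Inr ` {..<t} :: (nat + nat) set) = t"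
    by (simp_all add: card_image)
qed (auto simp: complete_bipartite_def Let_def)

text \<open>
  The function \<open>c(H)\<close>. Since every finite graph is isomorphic to one whose vertices are natural
  numbers, it suffices to let \<open>G\<close> range over those. Graphs have at least one vertex here, so that
  the quotient \<open>e(G)/|G|\<close> makes sense. The infimum is taken in the extended reals, so that it is
  meaningful without first showing that some \<open>c\<close> qualifies.
\<close>

definition minor_threshold :: "'h pair_pre_digraph \<Rightarrow> ereal" where
  "minor_threshold H = Inf (ereal ` {c :: real. \<forall>G :: nat pair_pre_digraph.
     pair_graph G \<and> pverts G \<noteq> {} \<and> edge_density G \<ge> c \<longrightarrow> is_minor H G})"

definition alpha_fun :: "real \<Rightarrow> real" where
  "alpha_fun p = p / (2 * sqrt (ln (1 / (1 - p))))"

definition alpha :: real where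
  "alpha = (GREATEST x. x \<in> alpha_fun ` {0<..<1})"

text \<open>The maximum is attained, so \<^const>\<open>alpha\<close> is well defined.\<close>

lemma alpha_attained: "\<exists>p \<in> {0<..<1}. alpha = alpha_fun p \<and> (\<forall>q \<in> {0<..<1}. alpha_fun q \<le> alpha_fun p)"
proof -
  let ?m = "alpha_fun (1/2)"
  have m: "?m > 0"
    by (simp add: alpha_fun_def)
  have "(alpha_fun \<longlongrightarrow> 0) (at_right 0)" "(alpha_fun \<longlongrightarrow> 0) (at_left 1)"
    unfolding alpha_fun_def by real_asymp+
  then have "eventually (\<lambda>x. alpha_fun x < ?m) (at_right 0)" "eventually (\<lambda>x. alpha_fun x < ?m) (at_left 1)"
    using m by (auto intro: order_tendstoD)
  then obtain a b where ab: "a > 0" "\<And>y. 0 < y \<Longrightarrow> y < a \<Longrightarrow> alpha_fun y < ?m"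
      "b < 1" "\<And>y. b < y \<Longrightarrow> y < 1 \<Longrightarrow> alpha_fun y < ?m"
    by (auto simp: eventually_at_right_field eventually_at_left_field)
  have half: "1/2 \<in> {a..b}"
    using ab(2)[of "1/2"] ab(4)[of "1/2"] by force
  have "continuous_on {a..b} alpha_fun"
    unfolding alpha_fun_def using ab by (intro continuous_intros) auto
  then obtain p where p: "p \<in> {a..b}" "\<And>q. q \<in> {a..b} \<Longrightarrow> alpha_fun q \<le> alpha_fun p"
    using continuous_attains_sup[of "{a..b}" alpha_fun] half by auto
  have max: "alpha_fun q \<le> alpha_fun p" if "q \<in> {0<..<1}" for q
    using that p(2)[of q] p(2)[OF half] ab(2)[of q] ab(4)[of q] by fastforce
  have "alpha = alpha_fun p"
    unfolding alpha_def using p(1) ab max by (intro Greatest_equality) auto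
  with p(1) ab max show ?thesis
    by (intro bexI[of _ p]) auto
qed

end

theory Submission
  imports Defs
begin

text \<open>
  Take a random graph on \<open>n \<approx> 2 t \<surd>f / \<surd>(ln (1/(1-p)))\<close> vertices with edge probability \<open>p\<close>, where \<open>p\<close>
  attains the maximum \<^const>\<open>alpha\<close>; it has about \<open>p n\<^sup>2/2\<close> edges, that is, density about
  \<open>2 alpha t \<surd>f\<close>. For fixed classes \<open>A\<^sub>i\<close>, \<open>B\<^sub>j\<close> with \<open>i < s\<close>, \<open>j < t\<close>, the probability that all
  pairs are joined is \<open>\<Prod>(1 - (1-p) ^ (|A\<^sub>i| |B\<^sub>j|))\<close>. By convexity and AM-GM this is at most
  \<open>exp (- s t (1-p) powr (n\<^sup>2/(4 s t)))\<close>, which for \<open>s = \<lfloor>f t / ln t\<rfloor>\<close> and \<open>n\<close> slightly below the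
  stated value beats the number \<open>(s + t + 1) ^ n\<close> of choices of the classes.
\<close>

section \<open>Random subsets\<close>

text \<open>A finite weighted sum stands in for the integral over a product measure: each element of
  \<open>K\<close> is kept independently with probability \<open>p\<close>.\<close>

definition random_subset_expectation :: "real \<Rightarrow> 'a set \<Rightarrow> ('a set \<Rightarrow> real) \<Rightarrow> real" where
  "random_subset_expectation p K g = (\<Sum>E\<in>Pow K. p ^ card E * (1 - p) ^ card (K - E) * g E)"

text \<open>Independence of the choices inside and outside \<open>F\<close>: the weight of
  \<open>E\<close> is the product of the weights of \<open>E \<inter> F\<close> and
  \<open>E - F\<close>.\<close>

lemma random_subset_expectation_split:
  assumes "finite K" "F \<subseteq> K"
  shows "random_subset_expectation p K (\<lambda>E. g (E \<inter> F) * h (E - F)) =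
    random_subset_expectation p F g * random_subset_expectation p (K - F) h"
proof -
  let ?w = "\<lambda>K E. p ^ card E * (1 - p) ^ card (K - E)"
  have "random_subset_expectation p F g * random_subset_expectation p (K - F) h =
      (\<Sum>(A, B)\<in>Pow F \<times> Pow (K - F). (?w F A * g A) * (?w (K - F) B * h B))"
    by (simp add: random_subset_expectation_def sum_product sum.cartesian_product)
  also have "\<dots> = (\<Sum>E\<in>Pow K. ?w K E * (g (E \<inter> F) * h (E - F)))"
  proof (rule sum.reindex_bij_witness[where i = "\<lambda>E. (E \<inter> F, E - F)" and j = "\<lambda>(A, B). A \<union> B"], goal_cases)
    \<comment> \<open>The fifth goal compares the summands; the other four say that the two maps are
      inverse bijections.\<close>
    case (5 x)
    obtain A B where x: "x = (A, B)" "A \<subseteq> F" "B \<subseteq> K - F"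
      using 5 by auto
    have fin: "finite A" "finite B" "finite F" "finite (K - F)"
      using x assms by (auto intro: finite_subset)
    have "card (A \<union> B) = card A + card B"
      using x fin by (intro card_Un_disjoint) auto
    moreover have "K - (A \<union> B) = (F - A) \<union> (K - F - B)"
      using x assms by auto
    then have "card (K - (A \<union> B)) = card (F - A) + card (K - F - B)"
      using x fin by (simp, intro card_Un_disjoint) auto
    moreover have "(A \<union> B) \<inter> F = A" "A \<union> B - F = B"
      using x by auto
    ultimately show ?case
      using x by (simp add: power_add)
  qed (use assms in auto)
  finally show ?thesis
    by (simp add: random_subset_expectation_def)
qed

lemma random_subset_expectation_const:
  assumes "finite K"
  shows "random_subset_expectation p K (\<lambda>_. c) = c"
proof -
  have "random_subset_expectation p K (\<lambda>_. 1) = 1"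
    using assms
  proof (induction K rule: finite_induct)
    case empty
    then show ?case by (simp add: random_subset_expectation_def)
  next
    case (insert x K)
    have "random_subset_expectation p {x} (\<lambda>_. 1) = 1"
      by (simp add: random_subset_expectation_def Pow_insert)
    then show ?case
      using insert random_subset_expectation_split[of "insert x K" "{x}" p "\<lambda>_. 1" "\<lambda>_. 1"] by simp
  qed
  then show ?thesis
    by (simp add: random_subset_expectation_def flip: sum_distrib_right)
qed

lemma random_subset_expectation_mono:
  assumes "0 \<le> p" "p \<le> 1" "\<And>E. E \<subseteq> K \<Longrightarrow> g E \<le> h E"
  shows "random_subset_expectation p K g \<le> random_subset_expectation p K h"
  unfolding random_subset_expectation_def
  using assms by (intro sum_mono mult_left_mono) auto

lemma random_subset_expectation_diff:
  "random_subset_expectation p K (\<lambda>E. g E - h E) =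
    random_subset_expectation p K g - random_subset_expectation p K h"
  by (simp add: random_subset_expectation_def algebra_simps sum_subtractf)

lemma random_subset_expectation_cmult:
  "random_subset_expectation p K (\<lambda>E. c * g E) = c * random_subset_expectation p K g"
  by (simp add: random_subset_expectation_def sum_distrib_left algebra_simps)

lemma random_subset_expectation_sum:
  "random_subset_expectation p K (\<lambda>E. \<Sum>i\<in>I. g i E) = (\<Sum>i\<in>I. random_subset_expectation p K (g i))"
  by (simp add: random_subset_expectation_def sum_distrib_left sum.swap[of _ I])

lemma random_subset_hits:
  assumes "finite F"
  shows "random_subset_expectation p F (\<lambda>E. of_bool (E \<noteq> {})) = 1 - (1 - p) ^ card F"
proof -
  have "random_subset_expectation p F (\<lambda>E. of_bool (E = {})) = (1 - p) ^ card F"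
    using assms by (simp add: random_subset_expectation_def of_bool_def if_distrib sum.delta' cong: if_cong)
  moreover have "random_subset_expectation p F (\<lambda>E. of_bool (E \<noteq> {})) =
      random_subset_expectation p F (\<lambda>E. 1 - of_bool (E = {}))"
    by (rule arg_cong[where f = "random_subset_expectation p F"]) auto
  ultimately show ?thesis
    using assms by (simp add: random_subset_expectation_diff random_subset_expectation_const)
qed

text \<open>Disjoint sets are hit independently, so \<open>F i\<close> can be split off in an
  induction on \<open>I\<close>.\<close>

lemma random_subset_hits_all:
  assumes "finite I" "disjoint_family_on F I" "\<And>i. i \<in> I \<Longrightarrow> F i \<subseteq> K" "finite K"
  shows "random_subset_expectation p K (\<lambda>E. of_bool (\<forall>i\<in>I. E \<inter> F i \<noteq> {})) = (\<Prod>i\<in>I. 1 - (1 - p) ^ card (F i))"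
  using assms
proof (induction I arbitrary: K rule: finite_induct)
  case empty
  then show ?case by (simp add: random_subset_expectation_const)
next
  case (insert i I)
  have disj: "F i \<inter> F j = {}" if "j \<in> I" for j
    using insert.prems(1) insert.hyps(2) that by (auto simp: disjoint_family_on_def)
  \<comment> \<open>Removing \<open>F i\<close> from \<open>E\<close> does not affect whether
    \<open>F j\<close> is hit; this brings the indicator into the product form needed for
    splitting.\<close>
  have "(\<forall>j\<in>I. E \<inter> F j \<noteq> {}) \<longleftrightarrow> (\<forall>j\<in>I. (E - F i) \<inter> F j \<noteq> {})" for E
    using disj by blast
  then have "of_bool (\<forall>j\<in>insert i I. E \<inter> F j \<noteq> {}) =
      of_bool (E \<inter> F i \<noteq> {}) * (of_bool (\<forall>j\<in>I. (E - F i) \<inter> F j \<noteq> {}) :: real)" for E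
    by auto
  then have "random_subset_expectation p K (\<lambda>E. of_bool (\<forall>j\<in>insert i I. E \<inter> F j \<noteq> {})) =
      random_subset_expectation p (F i) (\<lambda>E. of_bool (E \<noteq> {})) *
      random_subset_expectation p (K - F i) (\<lambda>E. of_bool (\<forall>j\<in>I. E \<inter> F j \<noteq> {}))"
    using insert.prems by (simp only:, intro random_subset_expectation_split) auto
  also have "random_subset_expectation p (K - F i) (\<lambda>E. of_bool (\<forall>j\<in>I. E \<inter> F j \<noteq> {})) =
      (\<Prod>j\<in>I. 1 - (1 - p) ^ card (F j))"
  proof (rule insert.IH)
    show "disjoint_family_on F I"
      using insert.prems(1) by (auto simp: disjoint_family_on_def)
    show "F j \<subseteq> K - F i" if "j \<in> I" for j
      using that insert.prems(2)[of j] disj[of j] by blast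
  qed (use insert.prems in auto)
  finally show ?case
    using insert.prems insert.hyps finite_subset[of "F i" K] by (simp add: random_subset_hits)
qed

lemma random_subset_expectation_card:
  assumes "finite K"
  shows "random_subset_expectation p K (\<lambda>E. real (card E)) = p * card K"
proof -
  \<comment> \<open>Membership of \<open>x\<close> is phrased as hitting the singleton
    \<open>{x}\<close>, so that the hitting probability gives \<open>1 - (1 - p) ^ 1 = p\<close> for
    each summand.\<close>
  have "real (card E) = (\<Sum>x\<in>K. of_bool (\<forall>i\<in>{x}. E \<inter> {i} \<noteq> {}))" if "E \<subseteq> K" for E
    using that assms by (simp add: of_bool_def sum.If_cases Int_absorb1)
  then have "random_subset_expectation p K (\<lambda>E. real (card E)) =
      random_subset_expectation p K (\<lambda>E. \<Sum>x\<in>K. of_bool (\<forall>i\<in>{x}. E \<inter> {i} \<noteq> {}))"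
    unfolding random_subset_expectation_def by (intro sum.cong) auto
  also have "\<dots> = (\<Sum>x\<in>K. p)"
    unfolding random_subset_expectation_sum
    by (intro sum.cong refl, subst random_subset_hits_all)
       (use assms in \<open>auto simp: disjoint_family_on_def\<close>)
  finally show ?thesis by simp
qed

section \<open>Graphs given by sets of unordered pairs\<close>

definition pair_set :: "nat \<Rightarrow> nat set set" where
  "pair_set n = {e. e \<subseteq> {..<n} \<and> card e = 2}"

definition graph_of_edges :: "nat \<Rightarrow> nat set set \<Rightarrow> nat pair_pre_digraph" where
  "graph_of_edges n E = \<lparr> pverts = {..<n}, parcs = {(u, v). {u, v} \<in> E} \<rparr>"

lemma finite_pair_set: "finite (pair_set n)"
  by (rule finite_subset[of _ "Pow {..<n}"]) (auto simp: pair_set_def)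

lemma card_pair_set: "real (card (pair_set n)) = real n * (real n - 1) / 2"
proof -
  have "card (pair_set n) = n choose 2"
    using n_subsets[of "{..<n}" 2] by (simp add: pair_set_def)
  then show ?thesis
    by (cases n) (auto simp: choose_two real_of_nat_div algebra_simps)
qed

lemma pair_graph_graph_of_edges:
  assumes "E \<subseteq> pair_set n"
  shows "pair_graph (graph_of_edges n E)"
proof -
  have *: "u < n \<and> v < n \<and> u \<noteq> v" if "{u, v} \<in> E" for u v
    using that assms by (auto simp: pair_set_def card_insert_if split: if_splits)
  have fin: "finite {(u, v). {u, v} \<in> E}"
    by (rule finite_subset[of _ "{..<n} \<times> {..<n}"]) (use * in auto)
  show ?thesis
    by unfold_locales
      (use fin in \<open>auto dest: * simp: graph_of_edges_def symmetric_def sym_def arcs_ends_def arc_to_ends_def insert_commute\<close>)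
qed

lemma edges_graph_of_edges:
  assumes "E \<subseteq> pair_set n"
  shows "edges (graph_of_edges n E) = E"
proof
  show "E \<subseteq> edges (graph_of_edges n E)"
  proof
    fix e assume e: "e \<in> E"
    then have "card e = 2"
      using assms by (auto simp: pair_set_def)
    then obtain u v where "e = {u, v}"
      by (auto simp: card_2_iff)
    with e show "e \<in> edges (graph_of_edges n E)"
      by (auto simp: edges_def graph_of_edges_def)
  qed
qed (auto simp: edges_def graph_of_edges_def)

section \<open>Complete bipartite minors of random graphs\<close>

text \<open>\<open>\<phi>\<close> labels each vertex with the class containing it, or with
  \<open>None\<close> if there is none. With labellings the classes are disjoint automatically and
  their choices are easy to count.\<close>

definition class_pairs :: "nat \<Rightarrow> (nat \<Rightarrow> (nat + nat) option) \<Rightarrow> nat \<times> nat \<Rightarrow> nat set set" where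
  "class_pairs n \<phi> = (\<lambda>(i, j). (\<lambda>(u, v). {u, v}) `
     ({u. u < n \<and> \<phi> u = Some (Inl i)} \<times> {v. v < n \<and> \<phi> v = Some (Inr j)}))"

lemma class_pairs_subset: "class_pairs n \<phi> ij \<subseteq> pair_set n"
proof (cases ij)
  case (Pair i j)
  have "card {u, v} = 2" if "\<phi> u = Some (Inl i)" "\<phi> v = Some (Inr j)" for u v
    using that by (cases "u = v") auto
  then show ?thesis
    by (auto simp: class_pairs_def pair_set_def Pair)
qed

text \<open>Of the two ends of a pair, one has an \<open>Inl\<close> label and the other an
  \<open>Inr\<close> label, and these recover \<open>i\<close> and \<open>j\<close>. Hence the
  hitting events are independent.\<close>

lemma class_pairs_disjoint: "disjoint_family_on (class_pairs n \<phi>) I"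
  by (auto simp: disjoint_family_on_def class_pairs_def doubleton_eq_iff)

lemma card_class_pairs:
  "card (class_pairs n \<phi> (i, j)) =
    card {u. u < n \<and> \<phi> u = Some (Inl i)} * card {v. v < n \<and> \<phi> v = Some (Inr j)}"
  unfolding class_pairs_def
  by (simp, subst card_image) (auto simp: inj_on_def doubleton_eq_iff card_cartesian_product)

section \<open>Probability that a fixed labelling has edges between all pairs of classes\<close>

lemma sum_exp_ge_of_sum_ge:
  fixes x :: "'a \<Rightarrow> real"
  assumes "(\<Sum>k\<in>I. x k) \<ge> real (card I) * m"
  shows "(\<Sum>k\<in>I. exp (x k)) \<ge> real (card I) * exp m"
proof -
  \<comment> \<open>Jensen's inequality for \<open>exp\<close> by hand: the function lies above its
    tangent at \<open>m\<close>, and the tangent bounds are summed.\<close>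
  have "exp m * (1 + x k - m) \<le> exp (x k)" for k
    using exp_ge_add_one_self[of "x k - m"] by (simp add: exp_diff field_simps)
  then have "(\<Sum>k\<in>I. exp m * (1 + x k - m)) \<le> (\<Sum>k\<in>I. exp (x k))"
    by (intro sum_mono)
  also have "(\<Sum>k\<in>I. exp m * (1 + x k - m)) = exp m * (real (card I) + (\<Sum>k\<in>I. x k) - real (card I) * m)"
    by (simp add: sum.distrib sum_subtractf algebra_simps flip: sum_distrib_left)
  also have "\<dots> \<ge> exp m * real (card I)"
    using assms by (intro mult_left_mono) auto
  finally show ?thesis
    by (simp add: mult.commute)
qed

text \<open>The probability is a product of factors \<open>1 - q\<close>, where \<open>q\<close> is
  a power of \<open>1 - p\<close>. The bound \<open>1 - q \<le> exp (- q)\<close> leaves the sum of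
  the \<open>q\<close>, which Jensen bounds below through the mean exponent; that mean is at most
  \<open>n^2 / (4 s t)\<close>.\<close>

lemma class_pairs_hit_bound:
  assumes p: "0 < p" "p < 1" and "s > 0" "t > 0"
  shows "random_subset_expectation p (pair_set n)
      (\<lambda>E. of_bool (\<forall>ij\<in>{..<s} \<times> {..<t}. E \<inter> class_pairs n \<phi> ij \<noteq> {}))
    \<le> exp (- (real (s * t) * exp (- (ln (1 / (1 - p)) * real n ^ 2 / (4 * real (s * t))))))"
proof -
  define L where "L = ln (1 / (1 - p))"
  define A where "A i = {u. u < n \<and> \<phi> u = Some (Inl i)}" for i
  define B where "B j = {v. v < n \<and> \<phi> v = Some (Inr j)}" for j
  define a where "a = (\<Sum>i<s. card (A i))"
  define b where "b = (\<Sum>j<t. card (B j))"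
  let ?I = "{..<s} \<times> {..<t}"
  let ?m = "- (L * real n ^ 2 / (4 * real (s * t)))"
  have L: "L > 0" "1 - p = exp (- L)"
    using p by (auto simp: L_def ln_div)
  have "a = card (\<Union>i<s. A i)" "b = card (\<Union>j<t. B j)"
    unfolding a_def b_def by (subst card_UN_disjoint; force simp: A_def B_def)+
  moreover have "card (\<Union>i<s. A i) + card (\<Union>j<t. B j) = card ((\<Union>i<s. A i) \<union> (\<Union>j<t. B j))"
    by (rule card_Un_disjoint[symmetric]) (auto simp: A_def B_def)
  moreover have "\<dots> \<le> card {..<n}"
    by (rule card_mono) (auto simp: A_def B_def)
  ultimately have "a + b \<le> n" by simp
  then have "(real a + real b)\<^sup>2 \<le> real n ^ 2"
    by (intro power_mono) auto
  \<comment> \<open>AM-GM in the form \<open>4 a b \<le> (a + b)^2\<close>.\<close>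
  then have ab: "real a * real b \<le> real n ^ 2 / 4"
    using zero_le_power2[of "real a - real b"] by (simp add: power2_eq_square algebra_simps)
  \<comment> \<open>The double sum factors, so only the total sizes \<open>a\<close> and
    \<open>b\<close> of the two sides matter, not how they are divided into classes.\<close>
  have "(\<Sum>(i, j)\<in>?I. - (L * (card (A i) * card (B j)))) = - (L * (real a * real b))"
    unfolding a_def b_def of_nat_sum sum_product
    by (simp add: sum_distrib_left sum_negf flip: sum.cartesian_product)
  also have "\<dots> \<ge> - (L * (real n ^ 2 / 4))"
    using ab L by (intro le_imp_neg_le mult_left_mono) auto
  finally have "(\<Sum>(i, j)\<in>?I. - (L * (card (A i) * card (B j)))) \<ge> real (card ?I) * ?m"
    using assms by (simp add: field_simps)
  note sum_exp_ge_of_sum_ge[OF this]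
  moreover have hit_prob: "(\<Sum>ij\<in>?I. (1 - p) ^ card (class_pairs n \<phi> ij)) =
      (\<Sum>ij\<in>?I. exp (case ij of (i, j) \<Rightarrow> - (L * (card (A i) * card (B j)))))"
    by (intro sum.cong) (auto simp: L(2) card_class_pairs A_def B_def mult_ac simp flip: exp_of_nat_mult)
  ultimately
  have jensen: "(\<Sum>ij\<in>?I. (1 - p) ^ card (class_pairs n \<phi> ij)) \<ge> real (s * t) * exp ?m"
    unfolding hit_prob by simp
  have "random_subset_expectation p (pair_set n) (\<lambda>E. of_bool (\<forall>ij\<in>?I. E \<inter> class_pairs n \<phi> ij \<noteq> {})) =
      (\<Prod>ij\<in>?I. 1 - (1 - p) ^ card (class_pairs n \<phi> ij))"
    by (intro random_subset_hits_all class_pairs_disjoint class_pairs_subset finite_pair_set) auto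
  also have "\<dots> \<le> (\<Prod>ij\<in>?I. exp (- ((1 - p) ^ card (class_pairs n \<phi> ij))))"
  proof (intro prod_mono conjI)
    fix ij
    show "0 \<le> 1 - (1 - p) ^ card (class_pairs n \<phi> ij)"
      using p by (simp add: power_le_one)
    show "1 - (1 - p) ^ card (class_pairs n \<phi> ij) \<le> exp (- ((1 - p) ^ card (class_pairs n \<phi> ij)))"
      using exp_ge_add_one_self[of "- ((1 - p) ^ card (class_pairs n \<phi> ij))"] by simp
  qed
  also have "\<dots> = exp (- (\<Sum>ij\<in>?I. (1 - p) ^ card (class_pairs n \<phi> ij)))"
    by (simp add: exp_sum sum_negf[symmetric])
  also have "\<dots> \<le> exp (- (real (s * t) * exp ?m))"
    using jensen by simp
  finally show ?thesis
    by (simp add: L_def)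
qed

section \<open>From minors to labellings, and the union bound\<close>

lemma is_minor_imp_class_pairs_hit:
  assumes "is_minor (complete_bipartite s t) (graph_of_edges n E)"
  obtains \<phi> where "\<phi> \<in> {..<n} \<rightarrow>\<^sub>E insert None (Some ` (Inl ` {..<s} \<union> Inr ` {..<t}))"
    "\<forall>ij\<in>{..<s} \<times> {..<t}. E \<inter> class_pairs n \<phi> ij \<noteq> {}"
proof -
  let ?H = "complete_bipartite s t"
  have H: "pverts ?H = Inl ` {..<s} \<union> Inr ` {..<t}"
    "\<And>i j. i < s \<Longrightarrow> j < t \<Longrightarrow> (Inl i, Inr j) \<in> parcs ?H"
    by (auto simp: complete_bipartite_def Let_def)
  let ?G = "graph_of_edges n E"
  obtain V where V0: "\<forall>h \<in> pverts ?H. V h \<subseteq> pverts ?G \<and> V h \<noteq> {}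
        \<and> Digraph_Component.connected (with_proj ?G \<restriction> V h)"
      "disjoint_family_on V (pverts ?H)"
      "\<forall>(h, h') \<in> parcs ?H. \<exists>u \<in> V h. \<exists>v \<in> V h'. (u, v) \<in> parcs ?G"
    using assms unfolding is_minor_def by blast
  have V: "\<And>h. h \<in> pverts ?H \<Longrightarrow> V h \<subseteq> {..<n}"
    "disjoint_family_on V (pverts ?H)"
    "\<And>h h'. (h, h') \<in> parcs ?H \<Longrightarrow> \<exists>u \<in> V h. \<exists>v \<in> V h'. {u, v} \<in> E"
    subgoal using V0(1) by (auto simp: graph_of_edges_def)
    subgoal by (fact V0(2))
    subgoal using V0(3) by (auto simp: graph_of_edges_def)
    done
  \<comment> \<open>Disjointness of the branch sets makes the \<open>SOME\<close> unambiguous.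
    Restricting to \<open>{..<n}\<close> puts \<open>\<phi>\<close> into a finite extensional
    function space.\<close>
  define \<phi> where "\<phi> = (\<lambda>v\<in>{..<n}. if \<exists>h\<in>pverts ?H. v \<in> V h
    then Some (SOME h. h \<in> pverts ?H \<and> v \<in> V h) else None)"
  have \<phi>: "\<phi> v = Some h" if "h \<in> pverts ?H" "v \<in> V h" for v h
  proof -
    have "(SOME h. h \<in> pverts ?H \<and> v \<in> V h) = h"
      by (rule some_equality) (use that V(2) in \<open>auto simp: disjoint_family_on_def\<close>)
    then show ?thesis
      using that V(1) by (auto simp: \<phi>_def)
  qed
  show ?thesis
  proof
    show "\<phi> \<in> {..<n} \<rightarrow>\<^sub>E insert None (Some ` (Inl ` {..<s} \<union> Inr ` {..<t}))"
      unfolding H(1)[symmetric]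
    proof (rule PiE_I)
      fix v assume "v \<in> {..<n}"
      then show "\<phi> v \<in> insert None (Some ` pverts ?H)"
      proof (cases "\<exists>h\<in>pverts ?H. v \<in> V h")
        case True
        then obtain h where "h \<in> pverts ?H" "v \<in> V h" by blast
        with \<phi>[OF this] show ?thesis by simp
      qed (simp add: \<phi>_def)
    qed (simp add: \<phi>_def)
    show "\<forall>ij\<in>{..<s} \<times> {..<t}. E \<inter> class_pairs n \<phi> ij \<noteq> {}"
    proof (clarify)
      fix i j assume ij: "i < s" "j < t" "E \<inter> class_pairs n \<phi> (i, j) = {}"
      from V(3)[OF H(2)[OF ij(1,2)]] obtain u v
        where uv: "u \<in> V (Inl i)" "v \<in> V (Inr j)" "{u, v} \<in> E" by auto
      have h: "Inl i \<in> pverts ?H" "Inr j \<in> pverts ?H"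
        using ij H(1) by auto
      have "{u, v} \<in> class_pairs n \<phi> (i, j)"
        unfolding class_pairs_def
        using uv \<phi>[OF h(1) uv(1)] \<phi>[OF h(2) uv(2)] V(1)[OF h(1)] V(1)[OF h(2)] by auto
      then show False
        using uv(3) ij(3) by auto
    qed
  qed
qed

text \<open>Union bound: a minor forces some labelling to have all its class pairs hit, and there
  are \<open>(s + t + 1) ^ n\<close> labellings, the extra 1 counting \<open>None\<close>.\<close>

lemma random_graph_minor_bound:
  assumes p: "0 < p" "p < 1" and "s > 0" "t > 0"
  shows "random_subset_expectation p (pair_set n)
      (\<lambda>E. of_bool (is_minor (complete_bipartite s t) (graph_of_edges n E)))
    \<le> real (s + t + 1) ^ n *
       exp (- (real (s * t) * exp (- (ln (1 / (1 - p)) * real n ^ 2 / (4 * real (s * t))))))"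
proof -
  define X :: "(nat + nat) option set" where "X = insert None (Some ` (Inl ` {..<s} \<union> Inr ` {..<t}))"
  define hit where "hit \<phi> E \<longleftrightarrow> (\<forall>ij\<in>{..<s} \<times> {..<t}. E \<inter> class_pairs n \<phi> ij \<noteq> {})" for \<phi> E
  have "card (Inl ` {..<s} \<union> Inr ` {..<t} :: (nat + nat) set) = s + t"
    by (subst card_Un_disjoint) (auto simp: card_image)
  then have X: "finite X" "card X = s + t + 1"
    by (auto simp: X_def card_image)
  then have fin: "finite ({..<n} \<rightarrow>\<^sub>E X)"
    by (auto intro: finite_PiE)
  have "random_subset_expectation p (pair_set n)
      (\<lambda>E. of_bool (is_minor (complete_bipartite s t) (graph_of_edges n E)))
    \<le> random_subset_expectation p (pair_set n) (\<lambda>E. \<Sum>\<phi>\<in>{..<n} \<rightarrow>\<^sub>E X. of_bool (hit \<phi> E))"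
  proof (intro random_subset_expectation_mono)
    fix E
    show "of_bool (is_minor (complete_bipartite s t) (graph_of_edges n E))
        \<le> (\<Sum>\<phi>\<in>{..<n} \<rightarrow>\<^sub>E X. of_bool (hit \<phi> E) :: real)"
    proof (cases "is_minor (complete_bipartite s t) (graph_of_edges n E)")
      case True
      then obtain \<phi> where \<phi>: "\<phi> \<in> {..<n} \<rightarrow>\<^sub>E X" "hit \<phi> E"
        unfolding X_def hit_def by (rule is_minor_imp_class_pairs_hit)
      have "of_bool (hit \<phi> E) \<le> (\<Sum>\<phi>\<in>{..<n} \<rightarrow>\<^sub>E X. of_bool (hit \<phi> E) :: real)"
        by (rule member_le_sum[OF \<phi>(1)]) (use fin in auto)
      with True \<phi>(2) show ?thesis by simp
    qed (simp add: sum_nonneg)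
  qed (use p in auto)
  also have "\<dots> \<le> (\<Sum>\<phi>\<in>{..<n} \<rightarrow>\<^sub>E X.
      exp (- (real (s * t) * exp (- (ln (1 / (1 - p)) * real n ^ 2 / (4 * real (s * t)))))))"
    unfolding random_subset_expectation_sum hit_def by (intro sum_mono class_pairs_hit_bound assms)
  finally show ?thesis
    using X by (simp add: card_PiE)
qed

text \<open>
  Taking the expectation of \<open>e(G)\<close> minus the number of all pairs times the indicator of a minor
  secures many edges and the absence of a minor at once, without a concentration inequality.
\<close>

lemma exists_dense_graph_without_minor:
  assumes p: "0 < p" "p < 1" and "s > 0" "t > 0" "n \<ge> 2" "\<eta> < p"
    and bound: "real (s + t + 1) ^ n *
       exp (- (real (s * t) * exp (- (ln (1 / (1 - p)) * real n ^ 2 / (4 * real (s * t)))))) \<le> \<eta>"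
  shows "\<exists>G :: nat pair_pre_digraph. pair_graph G \<and> pverts G \<noteq> {} \<and>
    edge_density G \<ge> (p - \<eta>) * (real n - 1) / 2 \<and> \<not> is_minor (complete_bipartite s t) G"
proof -
  let ?K = "pair_set n" and ?M = "\<lambda>E. is_minor (complete_bipartite s t) (graph_of_edges n E)"
  define N where "N = real (card ?K)"
  have N: "N = real n * (real n - 1) / 2"
    by (simp add: N_def card_pair_set)
  then have "N > 0"
    using \<open>n \<ge> 2\<close> by (simp only:) simp
  \<comment> \<open>By averaging, the penalised edge count of some \<open>E\<close> reaches the
    lower bound \<open>(p - \<eta>) * N\<close> on its mean.\<close>
  obtain E where E: "E \<subseteq> ?K" "real (card E) - N * of_bool (?M E) \<ge> (p - \<eta>) * N"
  proof (rule ccontr)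
    assume "\<not> thesis"
    then have less: "real (card E) - N * of_bool (?M E) < (p - \<eta>) * N" if "E \<subseteq> ?K" for E
      using that \<open>\<And>E. E \<subseteq> ?K \<Longrightarrow> (p - \<eta>) * N \<le> real (card E) - N * of_bool (?M E) \<Longrightarrow> thesis\<close>
      by (meson not_less)
    \<comment> \<open>All weights are positive because \<open>0 < p < 1\<close>, so the strict
      inequality carries over to the expectations.\<close>
    have "random_subset_expectation p ?K (\<lambda>E. real (card E) - N * of_bool (?M E))
        < random_subset_expectation p ?K (\<lambda>E. (p - \<eta>) * N)"
      unfolding random_subset_expectation_def
      by (rule sum_strict_mono) (use p less finite_pair_set in \<open>auto intro!: mult_strict_left_mono\<close>)
    then have "p * N - N * random_subset_expectation p ?K (\<lambda>E. of_bool (?M E)) < (p - \<eta>) * N"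
      by (simp add: random_subset_expectation_const random_subset_expectation_diff N_def
          random_subset_expectation_cmult random_subset_expectation_card finite_pair_set)
    then have "N * \<eta> < N * random_subset_expectation p ?K (\<lambda>E. of_bool (?M E))"
      by (simp add: algebra_simps)
    then show False
      using random_graph_minor_bound[OF p \<open>s > 0\<close> \<open>t > 0\<close>, of n] bound \<open>N > 0\<close> by simp
  qed
  \<comment> \<open>With a minor, the penalty \<open>N\<close> would leave at most 0, which is below
    \<open>(p - \<eta>) * N\<close>.\<close>
  have "real (card E) \<le> N"
    unfolding N_def using E(1) finite_pair_set by (simp add: card_mono)
  moreover have "(p - \<eta>) * N > 0"
    using \<open>N > 0\<close> \<open>\<eta> < p\<close> by simp
  ultimately have no_minor: "\<not> ?M E"
    using E(2) by (cases "?M E") auto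
  have "edge_density (graph_of_edges n E) = real (card E) / real n"
    using E(1) by (simp add: edge_density_def edges_graph_of_edges) (simp add: graph_of_edges_def)
  also have "\<dots> \<ge> (p - \<eta>) * N / real n"
    using E(2) no_minor by (intro divide_right_mono) auto
  also have "(p - \<eta>) * N / real n = (p - \<eta>) * (real n - 1) / 2"
    using \<open>n \<ge> 2\<close> by (simp add: N)
  finally show ?thesis
    using E(1) no_minor \<open>n \<ge> 2\<close> pair_graph_graph_of_edges
    by (intro exI[of _ "graph_of_edges n E"]) (auto simp: graph_of_edges_def lessThan_empty_iff)
qed

text \<open>Every admissible \<open>c\<close> exceeds the density of \<open>G\<close>, as otherwise
  \<open>G\<close> would contain the minor.\<close>

lemma minor_threshold_ge:
  fixes G :: "nat pair_pre_digraph"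
  assumes "pair_graph G" "pverts G \<noteq> {}" "edge_density G \<ge> d" "\<not> is_minor H G"
  shows "minor_threshold H \<ge> ereal d"
  unfolding minor_threshold_def
proof (rule Inf_greatest)
  fix x assume "x \<in> ereal ` {c. \<forall>G :: nat pair_pre_digraph.
     pair_graph G \<and> pverts G \<noteq> {} \<and> edge_density G \<ge> c \<longrightarrow> is_minor H G}"
  then obtain c where "x = ereal c" "\<not> edge_density G \<ge> c"
    using assms by blast
  then show "ereal d \<le> x"
    using assms by simp
qed

section \<open>Choice of the parameters\<close>

text \<open>The first condition makes rounding \<open>s\<close> cost at most a fraction
  \<open>\<delta>\<close>; the second lets the failure exponent beat the logarithm of the number of
  labellings; \<open>C\<close> collects further lower bounds on \<open>x\<close>.\<close>

lemma eventually_parameters: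
  fixes \<delta> c C :: real
  assumes "0 < \<delta>" "\<delta> < 1" "0 < c"
  shows "\<exists>X. \<forall>x\<ge>X. x / ln x \<ge> 1 / \<delta> \<and> (1 - \<delta>) * x powr \<delta> / ln x - c * ln (3 * x) \<ge> 1 \<and> x \<ge> C"
proof -
  have "filterlim (\<lambda>x. x / ln x) at_top (at_top :: real filter)"
    by real_asymp
  then have "\<forall>\<^sub>F x in at_top. (x :: real) / ln x \<ge> 1 / \<delta>"
    by (auto simp: filterlim_at_top)
  moreover have "1 - \<delta> > 0"
    using assms by simp
  then have "filterlim (\<lambda>x. (1 - \<delta>) * x powr \<delta> / ln x - c * ln (3 * x)) at_top at_top"
    using assms by real_asymp
  then have "\<forall>\<^sub>F x in at_top. (1 - \<delta>) * x powr \<delta> / ln x - c * ln (3 * x) \<ge> 1"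
    by (auto simp: filterlim_at_top)
  moreover have "\<forall>\<^sub>F x in at_top. x \<ge> C"
    by (rule eventually_ge_at_top)
  ultimately have "\<forall>\<^sub>F x in at_top. x / ln x \<ge> 1 / \<delta> \<and>
      (1 - \<delta>) * x powr \<delta> / ln x - c * ln (3 * x) \<ge> 1 \<and> x \<ge> C"
    by eventually_elim auto
  then show ?thesis
    by (auto simp: eventually_at_top_linorder)
qed

text \<open>Of the two factors \<open>1 - \<delta>\<close> in the square of \<open>c\<close>, one
  absorbs the rounding of \<open>s\<close> and the other keeps the inner exponent at most
  \<open>(1 - \<delta>) * ln t\<close>. The resulting gain of \<open>t powr \<delta>\<close> beats
  the number of labellings.\<close>

lemma minor_bound_small:
  fixes f \<delta> L \<eta> :: real
  defines "c \<equiv> 2 * (1 - \<delta>) / sqrt L"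
  assumes \<delta>: "0 < \<delta>" "\<delta> < 1" and L: "L > 0" and \<eta>: "\<eta> > 0"
    and f: "f \<ge> 1" "f \<le> ln (real t)"
    and x1: "real t / ln (real t) \<ge> 1 / \<delta>"
    and x2: "(1 - \<delta>) * real t powr \<delta> / ln (real t) - c * ln (3 * real t) \<ge> 1"
    and x3: "real t \<ge> - ln \<eta>"
    and s: "s = nat \<lfloor>f * real t / ln (real t)\<rfloor>"
    and n: "real n \<le> c * real t * sqrt f"
  shows "s > 0" and
    "real (s + t + 1) ^ n * exp (- (real (s * t) * exp (- (L * real n ^ 2 / (4 * real (s * t)))))) \<le> \<eta>"
proof -
  define x where "x = real t"
  note xs = x1[folded x_def] x2[folded x_def] x3[folded x_def]
  have x: "ln x \<ge> 1" "x > 1"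
  proof -
    show "ln x \<ge> 1"
      using f by (simp add: x_def)
    then have "ln x > 0" by simp
    then show "x > 1"
      \<comment> \<open>For \<open>t = 0\<close> the default value \<open>ln 0 = 0\<close>
        contradicts \<open>ln x > 0\<close>.\<close>
      by (cases "t = 0") (auto simp: x_def)
  qed
  define y where "y = f * x / ln x"
  have "x / ln x \<le> y"
    unfolding y_def using f x by (intro divide_right_mono) auto
  with xs(1) have "1 / \<delta> \<le> y"
    by linarith
  then have y: "\<delta> * y \<ge> 1"
    using \<delta> by (simp add: pos_divide_le_eq mult.commute)
  have ypos: "y > 0"
    using f x by (simp add: y_def)
  have "real s = of_int \<lfloor>y\<rfloor>"
    using ypos unfolding s x_def[symmetric] y_def[symmetric] by simp
  then have sy: "real s \<le> y" "real s \<ge> y - 1"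
    by linarith+
  \<comment> \<open>The floor loses at most 1, and \<open>1 \<le> \<delta> * y\<close>.\<close>
  then have sy': "real s \<ge> (1 - \<delta>) * y"
    using y by (simp add: left_diff_distrib)
  moreover have "(1 - \<delta>) * y > 0"
    using \<delta> ypos by simp
  ultimately have "real s > 0"
    by linarith
  then show "s > 0" by simp
  \<comment> \<open>Here \<open>f \<le> ln x\<close> enters: it gives \<open>s \<le> t\<close>,
    hence the factor 3 below.\<close>
  have "y \<le> x"
    using f x by (simp add: y_def x_def pos_divide_le_eq mult.commute)
  then have st: "real (s + t + 1) \<le> 3 * x"
    using sy x by (simp add: x_def)
  have st2: "real (s * t) \<ge> (1 - \<delta>) * f * x ^ 2 / ln x"
    using mult_right_mono[OF sy', of x] x by (simp add: y_def x_def power2_eq_square mult_ac)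
  have st2': "(1 - \<delta>) * f * x ^ 2 / ln x > 0"
    using \<delta> f x by simp
  have "real n ^ 2 \<le> (c * x * sqrt f) ^ 2"
    using n by (intro power_mono) (auto simp: x_def)
  also have "\<dots> = 4 * (1 - \<delta>)\<^sup>2 * x\<^sup>2 * f / L"
    unfolding c_def power_mult_distrib power_divide using f L by simp
  finally have "L * real n ^ 2 \<le> 4 * (1 - \<delta>)\<^sup>2 * x\<^sup>2 * f"
    using L by (simp add: field_simps)
  then have "L * real n ^ 2 / (4 * real (s * t)) \<le> 4 * (1 - \<delta>)\<^sup>2 * x\<^sup>2 * f / (4 * ((1 - \<delta>) * f * x ^ 2 / ln x))"
    using st2 st2' f by (intro frac_le) auto
  also have "\<dots> = (1 - \<delta>) * ln x"
    using f x \<delta> by (simp add: power2_eq_square)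
  finally have "exp (- (L * real n ^ 2 / (4 * real (s * t)))) \<ge> exp (- ((1 - \<delta>) * ln x))"
    by simp
  then have "real (s * t) * exp (- (L * real n ^ 2 / (4 * real (s * t))))
      \<ge> (1 - \<delta>) * f * x ^ 2 / ln x * exp (- ((1 - \<delta>) * ln x))"
    using st2 st2' by (intro mult_mono) auto
  also have "exp (- ((1 - \<delta>) * ln x)) = x powr \<delta> / x"
    using x by (simp add: powr_def algebra_simps exp_diff exp_add)
  also have "(1 - \<delta>) * f * x ^ 2 / ln x * (x powr \<delta> / x) = f * (x * ((1 - \<delta>) * x powr \<delta> / ln x))"
    using x by (simp add: power2_eq_square)
  \<comment> \<open>Weakening \<open>f\<close> to \<open>sqrt f\<close> matches the
    \<open>sqrt f\<close> in the bound on \<open>n\<close>, so that \<open>sqrt f * x\<close> can be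
    factored out of both exponents.\<close>
  also have "\<dots> \<ge> sqrt f * (x * ((1 - \<delta>) * x powr \<delta> / ln x))"
    using f x \<delta> real_sqrt_le_mono[of f "f\<^sup>2"]
    by (intro mult_right_mono) (auto simp: power2_eq_square)
  finally have main: "real (s * t) * exp (- (L * real n ^ 2 / (4 * real (s * t))))
      \<ge> sqrt f * x * ((1 - \<delta>) * x powr \<delta> / ln x)"
    by (simp add: mult_ac)
  have "real (s + t + 1) ^ n \<le> (3 * x) ^ n"
    using st by (intro power_mono) auto
  also have "\<dots> = exp (real n * ln (3 * x))"
    using x by (simp add: exp_of_nat_mult)
  also have "\<dots> \<le> exp (c * x * sqrt f * ln (3 * x))"
    using n x by (simp add: x_def mult_right_mono)
  finally have "real (s + t + 1) ^ n * exp (- (real (s * t) * exp (- (L * real n ^ 2 / (4 * real (s * t))))))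
      \<le> exp (c * x * sqrt f * ln (3 * x)) * exp (- (sqrt f * x * ((1 - \<delta>) * x powr \<delta> / ln x)))"
    using main by (intro mult_mono) auto
  also have "\<dots> = exp (- (sqrt f * x * ((1 - \<delta>) * x powr \<delta> / ln x - c * ln (3 * x))))"
    by (simp add: algebra_simps flip: exp_add)
  also have "\<dots> \<le> exp (- x)"
  proof -
    have "x * 1 \<le> (sqrt f * x) * ((1 - \<delta>) * x powr \<delta> / ln x - c * ln (3 * x))"
      using xs(2) f x by (intro mult_mono) auto
    then show ?thesis by simp
  qed
  also have "\<dots> \<le> exp (ln \<eta>)"
    using xs(3) by simp
  finally show "real (s + t + 1) ^ n * exp (- (real (s * t) * exp (- (L * real n ^ 2 / (4 * real (s * t)))))) \<le> \<eta>"
    using \<eta> by simp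
qed

theorem theorem1p9:
  fixes \<epsilon> :: real
  assumes "\<epsilon> > 0"
  shows "\<exists>T :: real. \<forall>(t :: nat) (f :: real). t > 0 \<and> T < f \<and> f \<le> ln (real t) \<longrightarrow>
    (\<exists>G :: nat pair_pre_digraph. pair_graph G \<and> pverts G \<noteq> {} \<and>
       edge_density G \<ge> (2 * alpha - \<epsilon>) * real t * sqrt f \<and>
       \<not> is_minor (complete_bipartite (nat \<lfloor>f * real t / ln (real t)\<rfloor>) t) G) \<and>
    minor_threshold (complete_bipartite (nat \<lfloor>f * real t / ln (real t)\<rfloor>) t)
      \<ge> ereal ((2 * alpha - \<epsilon>) * real t * sqrt f)"
proof -
  obtain p where p: "0 < p" "p < 1" "alpha = alpha_fun p"
    using alpha_attained by auto
  define L where "L = ln (1 / (1 - p))"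
  have L: "L > 0"
    using p by (auto simp: L_def ln_div)
  have alpha: "2 * alpha = p / sqrt L"
    by (simp add: p(3) alpha_fun_def L_def)
  \<comment> \<open>Small enough that replacing \<open>p / sqrt L\<close> by
    \<open>(1 - \<delta>)\<^sup>2 * p / sqrt L\<close> costs at most
    \<open>\<epsilon> / 2\<close>.\<close>
  define \<delta> where "\<delta> = min (1 / 2) (\<epsilon> * sqrt L / (4 * p))"
  have \<delta>: "0 < \<delta>" "\<delta> < 1" "2 * \<delta> * p / sqrt L \<le> \<epsilon> / 2"
  proof -
    have "\<delta> \<le> \<epsilon> * sqrt L / (4 * p)"
      by (simp add: \<delta>_def)
    then show "2 * \<delta> * p / sqrt L \<le> \<epsilon> / 2"
      using p L by (simp add: field_simps)
  qed (use assms p L in \<open>auto simp: \<delta>_def\<close>)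
  define c where "c = 2 * (1 - \<delta>) / sqrt L"
  have c: "c > 0"
    using \<delta> L by (simp add: c_def)
  \<comment> \<open>The three lower bounds serve, in order, a failure bound of
    \<open>\<delta> * p\<close>, \<open>n \<ge> 2\<close>, and the absorption of rounding losses in
    the density.\<close>
  obtain X where X: "\<And>x. x \<ge> X \<Longrightarrow> x / ln x \<ge> 1 / \<delta>"
      "\<And>x. x \<ge> X \<Longrightarrow> (1 - \<delta>) * x powr \<delta> / ln x - c * ln (3 * x) \<ge> 1"
      "\<And>x. x \<ge> X \<Longrightarrow> x \<ge> max (- ln (\<delta> * p)) (max (2 / c) (2 * p / \<epsilon>))"
    using eventually_parameters[OF \<delta>(1,2) c, of "max (- ln (\<delta> * p)) (max (2 / c) (2 * p / \<epsilon>))"] by blast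
  show ?thesis
  proof (intro exI[of _ "max 1 X"] allI impI)
    fix t :: nat and f :: real
    assume "t > 0 \<and> max 1 X < f \<and> f \<le> ln (real t)"
    then have t: "t > 0" "f \<ge> 1" "X \<le> f" "f \<le> ln (real t)"
      by auto
    \<comment> \<open>A lower bound on \<open>f\<close> is one on \<open>t\<close> too, since
      \<open>f \<le> ln t \<le> t\<close>.\<close>
    have tX: "real t \<ge> X"
      using t ln_bound[of "real t"] by simp
    define s where "s = nat \<lfloor>f * real t / ln (real t)\<rfloor>"
    define n where "n = nat \<lfloor>c * real t * sqrt f\<rfloor>"
    have tf: "real t * sqrt f \<ge> real t"
      using t by simp
    have t_ge: "real t \<ge> - ln (\<delta> * p)" "c * real t \<ge> 2" "\<epsilon> * real t \<ge> 2 * p"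
      using X(3)[OF tX] c assms by (auto simp: field_simps)
    have "c * real t * sqrt f \<ge> c * real t"
      using tf c by simp
    then have n: "real n \<le> c * real t * sqrt f" "real n \<ge> c * real t * sqrt f - 1" "n \<ge> 2"
      using t_ge unfolding n_def by linarith+
    \<comment> \<open>The choice \<open>\<eta> = \<delta> * p\<close> turns
      \<open>p - \<eta>\<close> into \<open>(1 - \<delta>) * p\<close>.\<close>
    have s: "s > 0" "real (s + t + 1) ^ n *
        exp (- (real (s * t) * exp (- (ln (1 / (1 - p)) * real n ^ 2 / (4 * real (s * t)))))) \<le> \<delta> * p"
      using minor_bound_small[OF \<delta>(1,2) L, of "\<delta> * p" f t s n] X(1,2)[OF tX] t t_ge n p \<delta>
      by (simp_all add: s_def c_def L_def)
    \<comment> \<open>The 2 combines the unit lost in rounding \<open>n\<close> with the one in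
      \<open>n - 1\<close>. Half of \<open>\<epsilon>\<close> pays for it, the other half for
      \<open>\<delta>\<close>.\<close>
    have "(2 * alpha - \<epsilon>) * real t * sqrt f \<le> (1 - \<delta>) * p * (c * real t * sqrt f - 2) / 2"
    proof -
      have "(1 - \<delta>) * p * c / 2 = p / sqrt L - 2 * \<delta> * p / sqrt L + \<delta>\<^sup>2 * p / sqrt L"
        using L by (simp add: c_def power2_eq_square field_simps)
      moreover have "\<delta>\<^sup>2 * p / sqrt L \<ge> 0"
        using p L by simp
      ultimately have "2 * alpha - \<epsilon> / 2 \<le> (1 - \<delta>) * p * c / 2"
        using \<delta>(3) alpha by linarith
      then have "(2 * alpha - \<epsilon> / 2) * (real t * sqrt f) \<le> (1 - \<delta>) * p * c / 2 * (real t * sqrt f)"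
        using t by (intro mult_right_mono) auto
      moreover have "(1 - \<delta>) * p \<le> \<epsilon> / 2 * (real t * sqrt f)"
      proof -
        have "(1 - \<delta>) * p \<le> p"
          using \<delta> p by (simp add: algebra_simps)
        also have "\<dots> \<le> \<epsilon> / 2 * real t"
          using t_ge by simp
        also have "\<dots> \<le> \<epsilon> / 2 * (real t * sqrt f)"
          using tf assms by simp
        finally show ?thesis .
      qed
      ultimately show ?thesis
        by (simp add: algebra_simps)
    qed
    also have "\<dots> \<le> (1 - \<delta>) * p * (real n - 1) / 2"
      using n \<delta> p by (intro divide_right_mono mult_left_mono) auto
    finally have density: "(2 * alpha - \<epsilon>) * real t * sqrt f \<le> (p - \<delta> * p) * (real n - 1) / 2"
      by (simp add: algebra_simps)
    have "\<delta> * p < p"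
      using \<delta> p by simp
    from exists_dense_graph_without_minor[OF p(1,2) s(1) t(1) n(3) this s(2)]
    obtain G :: "nat pair_pre_digraph" where G: "pair_graph G" "pverts G \<noteq> {}"
      "edge_density G \<ge> (2 * alpha - \<epsilon>) * real t * sqrt f" "\<not> is_minor (complete_bipartite s t) G"
      using density by (meson order_trans)
    then show "(\<exists>G :: nat pair_pre_digraph. pair_graph G \<and> pverts G \<noteq> {} \<and>
       edge_density G \<ge> (2 * alpha - \<epsilon>) * real t * sqrt f \<and>
       \<not> is_minor (complete_bipartite (nat \<lfloor>f * real t / ln (real t)\<rfloor>) t) G) \<and>
      minor_threshold (complete_bipartite (nat \<lfloor>f * real t / ln (real t)\<rfloor>) t)
        \<ge> ereal ((2 * alpha - \<epsilon>) * real t * sqrt f)"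
      using minor_threshold_ge[OF G] unfolding s_def by blast
  qed
qed

end
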